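(* Let $N$ be a timelike ruled surface of type $N_-$ in $\mathbb{R}_1^3$ with timelike striction curve $\vec c$ and curvatures $k_1,k_2$, and let $N^\gamma$ be a $\gamma$-transversal surface of $N$ with ruling $\vec q_\gamma=\mu\vec q+\eta\vec a$ whose striction curve $\vec c_\gamma$ coincides with $\vec c$. Let $\gamma$ be non-constant. Then $\vec c$ is an asymptotic line on $N$ if and only if $$\frac{k_1}{k_2}=\frac{\eta}{\mu}$$ holds.
   Context: $\mathbb{R}_1^3$ is Minkowski 3-space with metric $\langle\cdot,\cdot\rangle=-dx_1^2+dx_2^2+dx_3^2$. A nonzero vector $\vec v$ is timelike if $\langle\vec v,\vec v\rangle<0$, null if $\langle\vec v,\vec v\rangle=0$, spacelike if $\langle\vec v,\vec v\rangle>0$. Setting. All functions are smooth on an open interval $I$, and equations between functions are identities on $I$. A timelike ruled surface of type $N_-$ with timelike striction curve is $\vec r(s,v)=\vec c(s)+v\vec q(s)$, with ruling direction $\vec q$ unit timelike, where $\vec c$ is its striction curve, a timelike curve parametrized by arc length $s$. It has a Frenet frame $\{\vec q,\vec h,\vec a\}$ of mutually orthogonal vectors, $\langle\vec q,\vec q\rangle=-1$, $\langle\vec h,\vec h\rangle=\langle\vec a,\vec a\rangle=1$ ($\vec h$ is the central normal, i.e. the surface normal along $\vec c$; $\vec a$ the central tangent), with $\vec q\,'=k_1\vec h$, $\vec h'=k_1\vec q+k_2\vec a$, $\vec a'=-k_2\vec h$ (prime is $d/ds$) for functions $k_1,k_2$. Standing assumption: the frame vectors and their derivatives are non-null, and $\vec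 q\,'\neq0$ (i.e. $k_1\neq0$). The unit tangent of $\vec c$ is $\vec c\,'=\vec t=\cosh\theta\,\vec q+\sinh\theta\,\vec a$ for a real function $\theta$ (the hyperbolic angle between $\vec t$ and $\vec q$). $\gamma$-transversal surface. For a function $\gamma:I\to\mathbb{R}$, $N^\gamma$ is the ruled surface $\vec r_\gamma(s,v)=\vec c(s)+v\vec q_\gamma(s)$ with $\vec q_\gamma=\mu\vec q+\eta\vec a$, where $(\mu,\eta)=(\cosh\gamma,\sinh\gamma)$ if $\vec q_\gamma$ is timelike and $(\mu,\eta)=(\sinh\gamma,\cosh\gamma)$ if $\vec q_\gamma$ is spacelike; it is assumed that $\mu\ne0$ and $\eta\neq0$. Its striction curve is $\vec c_\gamma=\vec c+v_\gamma\vec q_\gamma$ with strictional distance $v_\gamma=-\langle\vec c\,',\vec q_\gamma'\rangle/\langle\vec q_\gamma',\vec q_\gamma'\rangle$ (this formula presupposes a nonzero denominator); it coincides with $\vec c$ if $v_\gamma=0$. The curve $\vec c$ is an asymptotic line on $N$ if $\langle\vec h,\vec c\,''\rangle=0$. *)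

theory Defs
  imports "HOL-Analysis.Analysis"
begin

definition lor :: "real^3 \<Rightarrow> real^3 \<Rightarrow> real" where
  "lor x y = - (x$1 * y$1) + x$2 * y$2 + x$3 * y$3"

definition timelike :: "real^3 \<Rightarrow> bool" where
  "timelike x \<longleftrightarrow> x \<noteq> 0 \<and> lor x x < 0"

definition null :: "real^3 \<Rightarrow> bool" where
  "null x \<longleftrightarrow> x \<noteq> 0 \<and> lor x x = 0"

definition spacelike :: "real^3 \<Rightarrow> bool" where
  "spacelike x \<longleftrightarrow> x \<noteq> 0 \<and> lor x x > 0"

abbreviation deriv1 :: "(real \<Rightarrow> 'a::real_normed_vector) \<Rightarrow> real \<Rightarrow> 'a" where
  "deriv1 f \<equiv> (\<lambda>s. vector_derivative f (at s))"

text \<open>Only used for open \<open>I\<close>, where the iterated derivatives at points of \<open>I\<close> depend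
  only on the values of \<open>f\<close> on \<open>I\<close>.\<close>

definition smooth_on :: "real set \<Rightarrow> (real \<Rightarrow> 'a::real_normed_vector) \<Rightarrow> bool" where
  "smooth_on I f \<longleftrightarrow> (\<forall>n. (deriv1 ^^ n) f differentiable_on I)"

definition ruled_surface ::
  "(real \<Rightarrow> real^3) \<Rightarrow> (real \<Rightarrow> real^3) \<Rightarrow> real \<Rightarrow> real \<Rightarrow> real^3" where
  "ruled_surface b p s v = b s + v *\<^sub>R p s"

text \<open>The striction curve of the ruled surface with base curve \<open>b\<close> and ruling \<open>p\<close>; the
  formula is meaningful only where \<^prop>\<open>lor (deriv1 p s) (deriv1 p s) \<noteq> 0\<close>.\<close>

definition strictional_distance ::
  "(real \<Rightarrow> real^3) \<Rightarrow> (real \<Rightarrow> real^3) \<Rightarrow> real \<Rightarrow> real" where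
  "strictional_distance b p s =
     - lor (deriv1 b s) (deriv1 p s) / lor (deriv1 p s) (deriv1 p s)"

definition striction_curve ::
  "(real \<Rightarrow> real^3) \<Rightarrow> (real \<Rightarrow> real^3) \<Rightarrow> real \<Rightarrow> real^3" where
  "striction_curve b p s = ruled_surface b p s (strictional_distance b p s)"

text \<open>The surface is timelike because each ruling direction \<open>q s\<close> is. Since null vectors are
  nonzero by definition, \<open>deriv_nonnull\<close> still allows \<open>k2\<close> to vanish.
  Several of the assumptions (e.g. \<open>striction\<close>, \<open>timelike_c\<close>, \<open>central_normal\<close>)
  follow from the frame equations; they record what \<open>c\<close> and \<open>h\<close> are.\<close>

locale ruled_surface_N_minus =
  fixes I :: "real set"
    and c q h a :: "real \<Rightarrow> real^3"
    and k1 k2 \<theta> :: "real \<Rightarrow> real"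
  assumes interval: "open I" "is_interval I" "I \<noteq> {}"
    and smooth: "smooth_on I c" "smooth_on I q" "smooth_on I h" "smooth_on I a"
      "smooth_on I k1" "smooth_on I k2" "smooth_on I \<theta>"
    and frame_norms: "\<And>s. s \<in> I \<Longrightarrow> lor (q s) (q s) = -1 \<and> lor (h s) (h s) = 1 \<and> lor (a s) (a s) = 1"
    and frame_orthogonal: "\<And>s. s \<in> I \<Longrightarrow> lor (q s) (h s) = 0 \<and> lor (q s) (a s) = 0 \<and> lor (h s) (a s) = 0"
    and frenet_q: "\<And>s. s \<in> I \<Longrightarrow> (q has_vector_derivative k1 s *\<^sub>R h s) (at s)"
    and frenet_h: "\<And>s. s \<in> I \<Longrightarrow> (h has_vector_derivative k1 s *\<^sub>R q s + k2 s *\<^sub>R a s) (at s)"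
    and frenet_a: "\<And>s. s \<in> I \<Longrightarrow> (a has_vector_derivative - k2 s *\<^sub>R h s) (at s)"
    and frame_nonnull: "\<And>s. s \<in> I \<Longrightarrow> \<not> null (q s) \<and> \<not> null (h s) \<and> \<not> null (a s)"
    and deriv_nonnull: "\<And>s. s \<in> I \<Longrightarrow> \<not> null (deriv1 q s) \<and> \<not> null (deriv1 h s) \<and> \<not> null (deriv1 a s)"
    and q_deriv_nonzero: "\<And>s. s \<in> I \<Longrightarrow> deriv1 q s \<noteq> 0"
    and tangent: "\<And>s. s \<in> I \<Longrightarrow>
      (c has_vector_derivative cosh (\<theta> s) *\<^sub>R q s + sinh (\<theta> s) *\<^sub>R a s) (at s)"
    and timelike_c: "\<And>s. s \<in> I \<Longrightarrow> timelike (deriv1 c s)"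
    and arc_length: "\<And>s. s \<in> I \<Longrightarrow> lor (deriv1 c s) (deriv1 c s) = -1"
    and striction: "\<And>s. s \<in> I \<Longrightarrow> striction_curve c q s = c s"
    and central_normal: "\<And>s. s \<in> I \<Longrightarrow>
      lor (h s) (deriv1 (\<lambda>t. ruled_surface c q t 0) s) = 0 \<and>
      lor (h s) (deriv1 (\<lambda>v. ruled_surface c q s v) 0) = 0"

definition transversal_ruling ::
  "(real \<Rightarrow> real^3) \<Rightarrow> (real \<Rightarrow> real^3) \<Rightarrow> (real \<Rightarrow> real) \<Rightarrow> (real \<Rightarrow> real) \<Rightarrow> real \<Rightarrow> real^3" where
  "transversal_ruling q a \<mu> \<eta> s = \<mu> s *\<^sub>R q s + \<eta> s *\<^sub>R a s"

text \<open>The transversal surface itself is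
  \<^term>\<open>ruled_surface c (transversal_ruling q a \<mu> \<eta>)\<close>, over the same base curve \<open>c\<close>.\<close>

definition gamma_transversal ::
  "real set \<Rightarrow> (real \<Rightarrow> real^3) \<Rightarrow> (real \<Rightarrow> real^3) \<Rightarrow>
   (real \<Rightarrow> real) \<Rightarrow> (real \<Rightarrow> real) \<Rightarrow> (real \<Rightarrow> real) \<Rightarrow> bool" where
  "gamma_transversal I q a \<gamma> \<mu> \<eta> \<longleftrightarrow>
     smooth_on I \<gamma> \<and>
     ((\<forall>s\<in>I. timelike (transversal_ruling q a \<mu> \<eta> s) \<and> \<mu> s = cosh (\<gamma> s) \<and> \<eta> s = sinh (\<gamma> s)) \<or>
      (\<forall>s\<in>I. spacelike (transversal_ruling q a \<mu> \<eta> s) \<and> \<mu> s = sinh (\<gamma> s) \<and> \<eta> s = cosh (\<gamma> s))) \<and>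
     (\<forall>s\<in>I. \<mu> s \<noteq> 0 \<and> \<eta> s \<noteq> 0)"

text \<open>\<open>c\<close> is an asymptotic line on the surface whose normal along \<open>c\<close> is \<open>h\<close>.\<close>

definition asymptotic_line ::
  "real set \<Rightarrow> (real \<Rightarrow> real^3) \<Rightarrow> (real \<Rightarrow> real^3) \<Rightarrow> bool" where
  "asymptotic_line I h c \<longleftrightarrow> (\<forall>s\<in>I. lor (h s) (deriv1 (deriv1 c) s) = 0)"

end

theory Submission
  imports Defs
begin

text \<open>The striction curves coincide iff \<open>\<langle>c', q\<^sub>\<gamma>'\<rangle> = 0\<close>. For spacelike \<open>q\<^sub>\<gamma>\<close> this reads
  \<open>\<gamma>' cosh (\<theta> - \<gamma>) = 0\<close>, which would make \<open>\<gamma>\<close> constant. So \<open>q\<^sub>\<gamma>\<close> is timelike and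
  \<open>\<gamma>' sinh (\<theta> - \<gamma>) = 0\<close>, hence \<open>\<theta> = \<gamma>\<close> wherever \<open>\<gamma>' \<noteq> 0\<close>. There
  \<open>\<langle>h, c''\<rangle> = k\<^sub>1 cosh \<theta> - k\<^sub>2 sinh \<theta>\<close> equals \<open>k\<^sub>1 \<mu> - k\<^sub>2 \<eta>\<close>. Conversely
  \<open>\<langle>q\<^sub>\<gamma>', q\<^sub>\<gamma>'\<rangle> = \<gamma>'\<^sup>2 + (k\<^sub>1 \<mu> - k\<^sub>2 \<eta>)\<^sup>2 \<noteq> 0\<close> forces \<open>\<gamma>' \<noteq> 0\<close> wherever \<open>k\<^sub>1 \<mu> = k\<^sub>2 \<eta>\<close>.
  If \<open>c\<close> is asymptotic, the sets \<open>\<gamma>' \<noteq> 0\<close> and \<open>k\<^sub>1 \<mu> = k\<^sub>2 \<eta>\<close> therefore agree; this set is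
  open and closed in the interval and nonempty, hence everything.\<close>

lemma lor_add: "lor (x + y) z = lor x z + lor y z" "lor z (x + y) = lor z x + lor z y"
  by (simp_all add: lor_def algebra_simps)

lemma lor_scaleR: "lor (r *\<^sub>R x) y = r * lor x y" "lor x (r *\<^sub>R y) = r * lor x y"
  by (simp_all add: lor_def algebra_simps)

lemma lor_commute: "lor x y = lor y x"
  by (simp add: lor_def algebra_simps)

lemma smooth_on_has_real_derivative:
  fixes f :: "real \<Rightarrow> real"
  assumes "smooth_on I f" "open I" "s \<in> I"
  shows "(f has_real_derivative deriv1 f s) (at s)"
proof -
  have "(deriv1 ^^ 0) f differentiable_on I"
    using assms(1) unfolding smooth_on_def by blast
  then have "f differentiable at s"
    using assms(2,3) by (simp add: differentiable_on_eq_differentiable_at)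
  then show ?thesis
    by (simp add: vector_derivative_works has_real_derivative_iff_has_vector_derivative)
qed

lemma smooth_on_imp_continuous_on:
  assumes "smooth_on I f"
  shows "continuous_on I f" "continuous_on I (deriv1 f)"
proof -
  have "(deriv1 ^^ 0) f differentiable_on I" "(deriv1 ^^ 1) f differentiable_on I"
    using assms unfolding smooth_on_def by blast+
  then show "continuous_on I f" "continuous_on I (deriv1 f)"
    by (auto intro: differentiable_imp_continuous_on)
qed

text \<open>For non-constant \<open>\<gamma>\<close> this excludes the spacelike case and later
  supplies a point with nonzero derivative.\<close>

lemma smooth_on_deriv1_zero_imp_constant_on:
  fixes f :: "real \<Rightarrow> real"
  assumes "smooth_on I f" "open I" "is_interval I" "\<And>s. s \<in> I \<Longrightarrow> deriv1 f s = 0"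
  shows "f constant_on I"
proof -
  have "(f has_field_derivative 0) (at s within I)" if "s \<in> I" for s
    using smooth_on_has_real_derivative[OF assms(1,2) that] assms(4)[OF that]
    by (auto intro: has_field_derivative_at_within)
  then show ?thesis
    using has_field_derivative_zero_constant is_interval_convex[OF assms(3)]
    unfolding constant_on_def by blast
qed

context ruled_surface_N_minus
begin

lemma lor_frame:
  assumes "s \<in> I"
  shows "lor (q s) (q s) = -1" "lor (h s) (h s) = 1" "lor (a s) (a s) = 1"
    "lor (q s) (h s) = 0" "lor (h s) (q s) = 0" "lor (q s) (a s) = 0" "lor (a s) (q s) = 0"
    "lor (h s) (a s) = 0" "lor (a s) (h s) = 0"
  using frame_norms[OF assms] frame_orthogonal[OF assms] by (simp_all add: lor_commute)

lemma k1_nonzero: "s \<in> I \<Longrightarrow> k1 s \<noteq> 0"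
  using q_deriv_nonzero vector_derivative_at[OF frenet_q] by fastforce

lemma deriv1_c: "s \<in> I \<Longrightarrow> deriv1 c s = cosh (\<theta> s) *\<^sub>R q s + sinh (\<theta> s) *\<^sub>R a s"
  by (rule vector_derivative_at[OF tangent])

text \<open>Both \<open>q\<close> and \<open>a\<close> differentiate to multiples of
  \<open>h\<close>, which gives the \<open>h\<close>-component. The result serves the tangent of
  \<open>c\<close> as well as the transversal ruling.\<close>

lemma combination_q_a_has_vector_derivative:
  assumes "s \<in> I" "(\<mu> has_real_derivative \<mu>') (at s)" "(\<eta> has_real_derivative \<eta>') (at s)"
  shows "((\<lambda>s. \<mu> s *\<^sub>R q s + \<eta> s *\<^sub>R a s) has_vector_derivative
           \<mu>' *\<^sub>R q s + \<eta>' *\<^sub>R a s + (k1 s * \<mu> s - k2 s * \<eta> s) *\<^sub>R h s) (at s)"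
proof -
  have "((\<lambda>s. \<mu> s *\<^sub>R q s + \<eta> s *\<^sub>R a s) has_vector_derivative
           (\<mu> s *\<^sub>R k1 s *\<^sub>R h s + \<mu>' *\<^sub>R q s) + (\<eta> s *\<^sub>R - k2 s *\<^sub>R h s + \<eta>' *\<^sub>R a s)) (at s)"
    by (intro has_vector_derivative_add has_vector_derivative_scaleR assms frenet_q frenet_a)
  then show ?thesis
    by (simp add: algebra_simps)
qed

lemma lor_h_deriv2_c:
  assumes "s \<in> I"
  shows "lor (h s) (deriv1 (deriv1 c) s) = k1 s * cosh (\<theta> s) - k2 s * sinh (\<theta> s)"
proof -
  note \<theta>' = smooth_on_has_real_derivative[OF smooth(7) interval(1) assms]
  have "((\<lambda>s. cosh (\<theta> s)) has_real_derivative sinh (\<theta> s) * deriv1 \<theta> s) (at s)"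
    "((\<lambda>s. sinh (\<theta> s)) has_real_derivative cosh (\<theta> s) * deriv1 \<theta> s) (at s)"
    by (auto intro!: derivative_eq_intros \<theta>')
  note combination_q_a_has_vector_derivative[OF assms this]
  \<comment> \<open>The formula for \<open>deriv1 c\<close> is known only on \<open>I\<close>;
    openness of \<open>I\<close> lets it be differentiated once more.\<close>
  then have "(deriv1 c has_vector_derivative
      (sinh (\<theta> s) * deriv1 \<theta> s) *\<^sub>R q s + (cosh (\<theta> s) * deriv1 \<theta> s) *\<^sub>R a s
      + (k1 s * cosh (\<theta> s) - k2 s * sinh (\<theta> s)) *\<^sub>R h s) (at s)"
    by (rule has_vector_derivative_transform_within_open[OF _ interval(1) assms])
       (simp add: deriv1_c)
  from vector_derivative_at[OF this] show ?thesis
    by (simp add: lor_add lor_scaleR lor_frame[OF assms])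
qed

text \<open>The functions \<open>f\<close> and \<open>g\<close> stand for cosh and sinh of
  \<open>\<gamma>\<close>, in either order: \<open>\<mu>\<close> and \<open>\<eta>\<close> are
  prescribed only on \<open>I\<close>, so their derivatives are taken from functions given
  everywhere.\<close>

lemma deriv1_transversal_ruling:
  assumes "s \<in> I" "\<And>t. t \<in> I \<Longrightarrow> \<mu> t = f t" "\<And>t. t \<in> I \<Longrightarrow> \<eta> t = g t"
    and "(f has_real_derivative \<mu>') (at s)" "(g has_real_derivative \<eta>') (at s)"
  shows "lor (deriv1 c s) (deriv1 (transversal_ruling q a \<mu> \<eta>) s)
           = \<eta>' * sinh (\<theta> s) - \<mu>' * cosh (\<theta> s)"
    and "lor (deriv1 (transversal_ruling q a \<mu> \<eta>) s) (deriv1 (transversal_ruling q a \<mu> \<eta>) s)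
           = \<eta>'\<^sup>2 - \<mu>'\<^sup>2 + (k1 s * \<mu> s - k2 s * \<eta> s)\<^sup>2"
proof -
  have "(transversal_ruling q a \<mu> \<eta> has_vector_derivative
      \<mu>' *\<^sub>R q s + \<eta>' *\<^sub>R a s + (k1 s * f s - k2 s * g s) *\<^sub>R h s) (at s)"
    by (rule has_vector_derivative_transform_within_open
          [OF combination_q_a_has_vector_derivative[OF assms(1,4,5)] interval(1) assms(1)])
       (simp add: transversal_ruling_def assms(2,3))
  note * = vector_derivative_at[OF this]
  show "lor (deriv1 c s) (deriv1 (transversal_ruling q a \<mu> \<eta>) s)
      = \<eta>' * sinh (\<theta> s) - \<mu>' * cosh (\<theta> s)"
    unfolding * deriv1_c[OF assms(1)]
    by (simp add: lor_add lor_scaleR lor_frame[OF assms(1)])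
  show "lor (deriv1 (transversal_ruling q a \<mu> \<eta>) s) (deriv1 (transversal_ruling q a \<mu> \<eta>) s)
      = \<eta>'\<^sup>2 - \<mu>'\<^sup>2 + (k1 s * \<mu> s - k2 s * \<eta> s)\<^sup>2"
    unfolding *
    by (simp add: lor_add lor_scaleR lor_frame[OF assms(1)] power2_eq_square assms(1-3))
qed

end

text \<open>A nonzero ruling forces the strictional distance to vanish, and a nonzero denominator
  then forces its numerator to vanish.\<close>

lemma lor_deriv1_eq_zero_if_striction_curve_eq:
  assumes "striction_curve b p s = b s" "p s \<noteq> 0" "lor (deriv1 p s) (deriv1 p s) \<noteq> 0"
  shows "lor (deriv1 b s) (deriv1 p s) = 0"
  using assms by (simp add: striction_curve_def ruled_surface_def strictional_distance_def)

theorem theorem6p2: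
  fixes I :: "real set"
    and c q h a :: "real \<Rightarrow> real^3"
    and k1 k2 \<theta> \<gamma> \<mu> \<eta> :: "real \<Rightarrow> real"
  assumes "ruled_surface_N_minus I c q h a k1 k2 \<theta>"
    and "gamma_transversal I q a \<gamma> \<mu> \<eta>"
    and "\<forall>s\<in>I. lor (deriv1 (transversal_ruling q a \<mu> \<eta>) s) (deriv1 (transversal_ruling q a \<mu> \<eta>) s) \<noteq> 0"
    and "\<forall>s\<in>I. striction_curve c (transversal_ruling q a \<mu> \<eta>) s = c s"
    and "\<not> \<gamma> constant_on I"
  shows "asymptotic_line I h c \<longleftrightarrow> (\<forall>s\<in>I. k2 s \<noteq> 0 \<and> k1 s / k2 s = \<eta> s / \<mu> s)"
proof -
  interpret ruled_surface_N_minus I c q h a k1 k2 \<theta>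
    by fact
  let ?p = "transversal_ruling q a \<mu> \<eta>"
  have smooth_\<gamma>: "smooth_on I \<gamma>" and \<mu>\<eta>: "\<And>s. s \<in> I \<Longrightarrow> \<mu> s \<noteq> 0 \<and> \<eta> s \<noteq> 0"
    using assms(2) by (auto simp: gamma_transversal_def)
  have p_nonzero: "?p s \<noteq> 0" if "s \<in> I" for s
    using assms(2) that by (auto simp: gamma_transversal_def timelike_def spacelike_def)
  have orth: "lor (deriv1 c s) (deriv1 ?p s) = 0" if "s \<in> I" for s
    using assms(3,4) p_nonzero that by (intro lor_deriv1_eq_zero_if_striction_curve_eq) auto
  have hyp': "((\<lambda>s. cosh (\<gamma> s)) has_real_derivative sinh (\<gamma> s) * deriv1 \<gamma> s) (at s)"
    "((\<lambda>s. sinh (\<gamma> s)) has_real_derivative cosh (\<gamma> s) * deriv1 \<gamma> s) (at s)" if "s \<in> I" for s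
    by (auto intro!: derivative_eq_intros smooth_on_has_real_derivative smooth_\<gamma> interval(1) that)
  have not_spacelike: "\<not> (\<forall>s\<in>I. \<mu> s = sinh (\<gamma> s) \<and> \<eta> s = cosh (\<gamma> s))"
  proof
    assume *: "\<forall>s\<in>I. \<mu> s = sinh (\<gamma> s) \<and> \<eta> s = cosh (\<gamma> s)"
    have "deriv1 \<gamma> s = 0" if s: "s \<in> I" for s
    proof -
      \<comment> \<open>The order \<open>hyp'(2,1)\<close> reflects that \<open>\<mu>\<close> is
        sinh here. The cosh factor never vanishes.\<close>
      have "lor (deriv1 c s) (deriv1 ?p s) = - deriv1 \<gamma> s * cosh (\<theta> s - \<gamma> s)"
        using * by (subst deriv1_transversal_ruling(1)[OF s _ _ hyp'(2,1)[OF s]])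
          (auto simp: cosh_diff algebra_simps)
      then show ?thesis
        using orth[OF s] by simp
    qed
    then show False
      using smooth_on_deriv1_zero_imp_constant_on[OF smooth_\<gamma>] interval assms(5) by blast
  qed
  then have \<mu>_eq: "\<mu> s = cosh (\<gamma> s)" and \<eta>_eq: "\<eta> s = sinh (\<gamma> s)" if "s \<in> I" for s
    using assms(2) that unfolding gamma_transversal_def by blast+
  have theta_eq: "\<theta> s = \<gamma> s" if s: "s \<in> I" and "deriv1 \<gamma> s \<noteq> 0" for s
  proof -
    have "lor (deriv1 c s) (deriv1 ?p s) = deriv1 \<gamma> s * sinh (\<theta> s - \<gamma> s)"
      using \<mu>_eq \<eta>_eq by (subst deriv1_transversal_ruling(1)[OF s _ _ hyp'[OF s]])
        (auto simp: sinh_diff algebra_simps)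
    then show ?thesis
      using orth[OF s] that(2) by simp
  qed
  have deriv_nonzero: "deriv1 \<gamma> s \<noteq> 0" if s: "s \<in> I" and "k1 s * \<mu> s = k2 s * \<eta> s" for s
  proof
    assume "deriv1 \<gamma> s = 0"
    then have "lor (deriv1 ?p s) (deriv1 ?p s) = 0"
      using \<mu>_eq \<eta>_eq that(2)
      by (subst deriv1_transversal_ruling(2)[OF s _ _ hyp'[OF s]]) auto
    then show False
      using assms(3) s by blast
  qed
  \<comment> \<open>The product equation excludes \<open>k2 s = 0\<close>, as \<open>k1 s\<close>
    and \<open>\<mu> s\<close> are nonzero.\<close>
  have ratio: "k2 s \<noteq> 0 \<and> k1 s / k2 s = \<eta> s / \<mu> s \<longleftrightarrow> k1 s * \<mu> s = k2 s * \<eta> s" if "s \<in> I" for s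
    using k1_nonzero[OF that] \<mu>\<eta>[OF that] by (auto simp: field_simps)
  have "asymptotic_line I h c \<longleftrightarrow> (\<forall>s\<in>I. k1 s * \<mu> s = k2 s * \<eta> s)"
  proof
    assume *: "\<forall>s\<in>I. k1 s * \<mu> s = k2 s * \<eta> s"
    show "asymptotic_line I h c"
      unfolding asymptotic_line_def
    proof
      fix s assume s: "s \<in> I"
      then have "\<theta> s = \<gamma> s"
        using theta_eq deriv_nonzero * by blast
      then show "lor (h s) (deriv1 (deriv1 c) s) = 0"
        using * s by (simp add: lor_h_deriv2_c \<mu>_eq \<eta>_eq)
    qed
  next
    assume *: "asymptotic_line I h c"
    define A where "A = {s \<in> I. deriv1 \<gamma> s \<noteq> 0}"
    have "k1 s * \<mu> s = k2 s * \<eta> s" if "s \<in> A" for s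
      using * that theta_eq[of s] lor_h_deriv2_c[of s]
      by (auto simp: A_def asymptotic_line_def \<mu>_eq \<eta>_eq)
    \<comment> \<open>Expressing the condition through \<open>\<gamma>\<close> makes its continuity
      on \<open>I\<close> evident, so this description shows that \<open>A\<close> is closed, while
      the defining one shows that it is open.\<close>
    then have A_eq: "A = {s \<in> I. k1 s * cosh (\<gamma> s) - k2 s * sinh (\<gamma> s) = 0}"
      using deriv_nonzero \<mu>_eq \<eta>_eq by (auto simp: A_def)
    have "continuous_on I (\<lambda>s. k1 s * cosh (\<gamma> s) - k2 s * sinh (\<gamma> s))"
      by (intro continuous_intros smooth(5,6)[THEN smooth_on_imp_continuous_on(1)]
          smooth_on_imp_continuous_on(1)[OF smooth_\<gamma>])
    then have "closedin (top_of_set I) A"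
      unfolding A_eq by (rule continuous_closedin_preimage_constant)
    moreover have "openin (top_of_set I) A"
      using continuous_openin_preimage_gen[OF smooth_on_imp_continuous_on(2)[OF smooth_\<gamma>],
          of "- {0}"]
      by (simp add: A_def vimage_def Int_def open_Compl)
    moreover have "A \<noteq> {}"
      using smooth_on_deriv1_zero_imp_constant_on[OF smooth_\<gamma>] interval assms(5)
      by (auto simp: A_def)
    ultimately have "A = I"
      using is_interval_connected[OF interval(2)] unfolding connected_clopen by blast
    then show "\<forall>s\<in>I. k1 s * \<mu> s = k2 s * \<eta> s"
      using A_eq \<mu>_eq \<eta>_eq by auto
  qed
  with ratio show ?thesis
    by simp
qed

end
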